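(* For every $n\in\mathbb{N}=\{1,2,\dots\}$, the Banach space $\operatorname{Lip}_0(K_n)$ has the symmetric strong diameter $2$ property (SSD$2$P).
   Context: All Banach spaces are real. For $n\in\mathbb{N}$, $K_n$ is the metric subspace of $\ell_\infty$ consisting of all sequences with terms in $\{0,1,\dots,n\}$, with the metric $d(x,y)=\sup_j|x_j-y_j|$. For a pointed metric space $M$ (a metric space with metric $d$ and a fixed point $0\in M$), $\operatorname{Lip}_0(M)$ is the Banach space of all Lipschitz functions $f\colon M\to\mathbb{R}$ with $f(0)=0$, with norm $\|f\|=\sup\{|f(x)-f(y)|/d(x,y)\colon x,y\in M,\ x\neq y\}$. $K_n$ is regarded as a pointed metric space by fixing an arbitrary element as the base point (changing the base point does not change $\operatorname{Lip}_0$ up to isometric isomorphism). For a nontrivial Banach space $X$ with closed unit ball $B_X$ and dual unit sphere $S_{X^*}$, a slice of $B_X$ is a set $S(x^*,\alpha)=\{x\in B_X\colon x^*(x)>1-\alpha\}$ with $x^*\in S_{X^*}$ and $\alpha>0$. $X$ has the SSD$2$P if, for every $n\in\mathbb{N}$, every family $\{S_1,\dots,S_n\}$ of slices of $B_X$, and every $\varepsilon>0$, there exist $f_1\in S_1,\dots,f_n\in S_n$ and $g\in B_X$ with $\|g\|>1-\varepsilon$ such that $f_i\pm g\in S_i$ for every $i\in\{1,\dots,n\}$. *)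

theory Defs
  imports "HOL-Analysis.Analysis" "HOL-Library.Function_Algebras"
begin

section \<open>Real Banach spaces given by a carrier set and a norm\<close>

instantiation "fun" :: (type, real_vector) real_vector
begin

definition scaleR_fun :: "real \<Rightarrow> ('a \<Rightarrow> 'b) \<Rightarrow> 'a \<Rightarrow> 'b" where
  "scaleR_fun c f = (\<lambda>x. c *\<^sub>R f x)"

instance
  by standard (simp_all add: scaleR_fun_def fun_eq_iff scaleR_add_right scaleR_add_left)

end

definition banach_on :: "'v::real_vector set \<Rightarrow> ('v \<Rightarrow> real) \<Rightarrow> bool" where
  "banach_on V nrm \<longleftrightarrow>
     subspace V \<and>
     (\<forall>x\<in>V. 0 \<le> nrm x \<and> (nrm x = 0 \<longleftrightarrow> x = 0)) \<and>
     (\<forall>c. \<forall>x\<in>V. nrm (c *\<^sub>R x) = \<bar>c\<bar> * nrm x) \<and>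
     (\<forall>x\<in>V. \<forall>y\<in>V. nrm (x + y) \<le> nrm x + nrm y) \<and>
     (\<forall>X. (\<forall>n. X n \<in> V) \<and> (\<forall>e>0. \<exists>N. \<forall>m\<ge>N. \<forall>n\<ge>N. nrm (X m - X n) < e) \<longrightarrow>
       (\<exists>l\<in>V. (\<lambda>n. nrm (X n - l)) \<longlonglongrightarrow> 0))"

definition unit_ball :: "'v::real_vector set \<Rightarrow> ('v \<Rightarrow> real) \<Rightarrow> 'v set" where
  "unit_ball V nrm = {x \<in> V. nrm x \<le> 1}"

text \<open>Functionals are functions on the whole type, but only their values on \<open>V\<close> matter.\<close>

definition dual_space :: "'v::real_vector set \<Rightarrow> ('v \<Rightarrow> real) \<Rightarrow> ('v \<Rightarrow> real) set" where
  "dual_space V nrm = {\<phi>.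
     (\<forall>x\<in>V. \<forall>y\<in>V. \<phi> (x + y) = \<phi> x + \<phi> y) \<and>
     (\<forall>c. \<forall>x\<in>V. \<phi> (c *\<^sub>R x) = c * \<phi> x) \<and>
     (\<exists>C. \<forall>x\<in>V. \<bar>\<phi> x\<bar> \<le> C * nrm x)}"

definition dual_norm :: "'v::real_vector set \<Rightarrow> ('v \<Rightarrow> real) \<Rightarrow> ('v \<Rightarrow> real) \<Rightarrow> real" where
  "dual_norm V nrm \<phi> = (SUP x\<in>unit_ball V nrm. \<bar>\<phi> x\<bar>)"

definition dual_sphere :: "'v::real_vector set \<Rightarrow> ('v \<Rightarrow> real) \<Rightarrow> ('v \<Rightarrow> real) set" where
  "dual_sphere V nrm = {\<phi> \<in> dual_space V nrm. dual_norm V nrm \<phi> = 1}"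

definition slice :: "'v::real_vector set \<Rightarrow> ('v \<Rightarrow> real) \<Rightarrow> ('v \<Rightarrow> real) \<Rightarrow> real \<Rightarrow> 'v set" where
  "slice V nrm \<phi> \<alpha> = {x \<in> unit_ball V nrm. \<phi> x > 1 - \<alpha>}"

definition is_slice :: "'v::real_vector set \<Rightarrow> ('v \<Rightarrow> real) \<Rightarrow> 'v set \<Rightarrow> bool" where
  "is_slice V nrm S \<longleftrightarrow> (\<exists>\<phi>\<in>dual_sphere V nrm. \<exists>\<alpha>>0. S = slice V nrm \<phi> \<alpha>)"

text \<open>Symmetric strong diameter 2 property; meaningful for nontrivial Banach spaces
  (if \<open>V = {0}\<close>, there are no slices).\<close>

definition SSD2P :: "'v::real_vector set \<Rightarrow> ('v \<Rightarrow> real) \<Rightarrow> bool" where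
  "SSD2P V nrm \<longleftrightarrow>
     (\<forall>m\<ge>1. \<forall>S :: nat \<Rightarrow> 'v set. \<forall>\<epsilon>>0.
        (\<forall>i\<in>{1..m}. is_slice V nrm (S i)) \<longrightarrow>
        (\<exists>f :: nat \<Rightarrow> 'v. \<exists>g.
           (\<forall>i\<in>{1..m}. f i \<in> S i) \<and>
           g \<in> unit_ball V nrm \<and> nrm g > 1 - \<epsilon> \<and>
           (\<forall>i\<in>{1..m}. f i + g \<in> S i \<and> f i - g \<in> S i)))"


section \<open>Spaces of Lipschitz functions\<close>

text \<open>A function on \<open>M\<close> is represented by its extension by \<open>0\<close> to the whole type.\<close>

definition Lip0 :: "'a::metric_space set \<Rightarrow> 'a \<Rightarrow> ('a \<Rightarrow> real) set" where
  "Lip0 M p = {f. (\<exists>L. L-lipschitz_on M f) \<and> f p = 0 \<and> (\<forall>x. x \<notin> M \<longrightarrow> f x = 0)}"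

text \<open>The inserted \<open>0\<close> only matters when \<open>M\<close> has a single point (supremum in
  \<open>[0,\<infinity>)\<close> of the empty set).\<close>

definition lip_norm :: "'a::metric_space set \<Rightarrow> ('a \<Rightarrow> real) \<Rightarrow> real" where
  "lip_norm M f = Sup (insert 0 {\<bar>f x - f y\<bar> / dist x y | x y. x \<in> M \<and> y \<in> M \<and> x \<noteq> y})"

lemma lip_norm_bdd:
  assumes "L-lipschitz_on M f"
  shows "bdd_above (insert 0 {\<bar>f x - f y\<bar> / dist x y | x y. x \<in> M \<and> y \<in> M \<and> x \<noteq> y})"
proof -
  have "L \<ge> 0" using assms by (rule lipschitz_on_nonneg)
  moreover have "\<bar>f x - f y\<bar> / dist x y \<le> L" if "x \<in> M" "y \<in> M" "x \<noteq> y" for x y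
    using lipschitz_onD[OF assms that(1,2)] that by (simp add: pos_divide_le_eq dist_real_def)
  ultimately show ?thesis
    by (intro bdd_aboveI[of _ L]) blast
qed

lemma lip_norm_nonneg:
  assumes "L-lipschitz_on M f" shows "0 \<le> lip_norm M f"
  unfolding lip_norm_def by (rule cSup_upper) (auto intro: lip_norm_bdd[OF assms, simplified])

lemma lip_norm_le:
  assumes "L-lipschitz_on M f" shows "lip_norm M f \<le> L"
proof -
  have "L \<ge> 0" using assms by (rule lipschitz_on_nonneg)
  moreover have "\<bar>f x - f y\<bar> / dist x y \<le> L" if "x \<in> M" "y \<in> M" "x \<noteq> y" for x y
    using lipschitz_onD[OF assms that(1,2)] that by (simp add: pos_divide_le_eq dist_real_def)
  ultimately show ?thesis unfolding lip_norm_def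
    by (intro cSup_least) blast+
qed

lemma lipschitz_on_lip_norm:
  assumes "L-lipschitz_on M f" shows "(lip_norm M f)-lipschitz_on M f"
proof (rule lipschitz_onI)
  fix x y assume xy: "x \<in> M" "y \<in> M"
  show "dist (f x) (f y) \<le> lip_norm M f * dist x y"
  proof (cases "x = y")
    case False
    have "\<bar>f x - f y\<bar> / dist x y \<le> lip_norm M f"
      unfolding lip_norm_def using xy False
      by (intro cSup_upper lip_norm_bdd[OF assms]) auto
    then show ?thesis using False by (simp add: divide_simps dist_real_def)
  qed simp
qed (rule lip_norm_nonneg[OF assms])

lemma subspace_Lip0: "subspace (Lip0 M p)"
proof (rule subspaceI)
  show "0 \<in> Lip0 M p"
    by (auto simp: Lip0_def zero_fun_def intro!: exI[of _ 0] lipschitz_onI)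
next
  fix f g assume "f \<in> Lip0 M p" "g \<in> Lip0 M p"
  then show "f + g \<in> Lip0 M p"
    by (auto simp: Lip0_def plus_fun_def intro: lipschitz_on_add)
next
  fix c f assume "f \<in> Lip0 M p"
  then show "c *\<^sub>R f \<in> Lip0 M p"
    by (auto simp: Lip0_def scaleR_fun_def simp flip: real_scaleR_def intro: lipschitz_on_cmult)
qed

lemma Lip0_lipschitz: "f \<in> Lip0 M p \<Longrightarrow> (lip_norm M f)-lipschitz_on M f"
  by (auto simp: Lip0_def intro: lipschitz_on_lip_norm)

lemma lip_norm_scaleR_le:
  assumes "f \<in> Lip0 M p" shows "lip_norm M (c *\<^sub>R f) \<le> \<bar>c\<bar> * lip_norm M f"
  unfolding scaleR_fun_def
  by (rule lip_norm_le, rule lipschitz_on_cmult, rule Lip0_lipschitz[OF assms])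

lemma Lip0_abs_le:
  assumes "f \<in> Lip0 M p" "p \<in> M" "x \<in> M" shows "\<bar>f x\<bar> \<le> lip_norm M f * dist x p"
  using lipschitz_onD[OF Lip0_lipschitz[OF assms(1)] assms(3,2)] assms(1)
  by (simp add: Lip0_def dist_real_def)

lemma Lip0_complete:
  assumes p: "p \<in> M" and X: "\<And>n. X n \<in> Lip0 M p"
    and C: "\<And>e. e > 0 \<Longrightarrow> \<exists>N. \<forall>m\<ge>N. \<forall>n\<ge>N. lip_norm M (X m - X n) < e"
  shows "\<exists>l\<in>Lip0 M p. (\<lambda>n. lip_norm M (X n - l)) \<longlonglongrightarrow> 0"
proof -
  have D: "X m - X n \<in> Lip0 M p" for m n
    by (intro subspace_diff subspace_Lip0 X)
  have conv: "convergent (\<lambda>n. X n x)" for x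
  proof (cases "x \<in> M")
    case True
    have "Cauchy (\<lambda>n. X n x)"
    proof (rule metric_CauchyI)
      fix e :: real assume e: "e > 0"
      have pos: "dist x p + 1 > 0" using zero_le_dist[of x p] by linarith
      obtain N where N: "\<forall>m\<ge>N. \<forall>n\<ge>N. lip_norm M (X m - X n) < e / (dist x p + 1)"
        using C[of "e / (dist x p + 1)"] e pos by auto
      show "\<exists>N. \<forall>m\<ge>N. \<forall>n\<ge>N. dist (X m x) (X n x) < e"
      proof (intro exI[of _ N] allI impI)
        fix m n assume "N \<le> m" "N \<le> n"
        then have *: "lip_norm M (X m - X n) < e / (dist x p + 1)" using N by blast
        have "dist (X m x) (X n x) \<le> lip_norm M (X m - X n) * dist x p"
          using Lip0_abs_le[OF D p True, of m n] by (simp add: dist_real_def)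
        also have "\<dots> \<le> e / (dist x p + 1) * dist x p"
          using * by (intro mult_right_mono) auto
        also have "\<dots> < e" using e pos by (simp add: divide_simps)
        finally show "dist (X m x) (X n x) < e" .
      qed
    qed
    then show ?thesis by (rule real_Cauchy_convergent)
  next
    case False
    then have "(\<lambda>n. X n x) = (\<lambda>n. 0)" using X by (auto simp: Lip0_def)
    then show ?thesis by (simp add: convergent_const)
  qed
  define l where "l = (\<lambda>x. lim (\<lambda>n. X n x))"
  have lim: "(\<lambda>n. X n x) \<longlonglongrightarrow> l x" for x
    using conv[of x] by (simp add: l_def convergent_LIMSEQ_iff)
  have l0: "l x = 0" if "\<And>n. X n x = 0" for x
    using lim[of x] that LIMSEQ_unique[OF _ tendsto_const] by fastforce
  have key: "e-lipschitz_on M (X n - l)"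
    if e: "e > 0" and N: "\<forall>m\<ge>N. \<forall>n\<ge>N. lip_norm M (X m - X n) < e" and n: "n \<ge> N" for e N n
  proof (rule lipschitz_onI)
    fix x y assume xy: "x \<in> M" "y \<in> M"
    have "(\<lambda>m. dist ((X n - X m) x) ((X n - X m) y)) \<longlonglongrightarrow> dist ((X n - l) x) ((X n - l) y)"
      unfolding fun_diff_def by (intro tendsto_intros lim)
    moreover have "\<forall>\<^sub>F m in sequentially. dist ((X n - X m) x) ((X n - X m) y) \<le> e * dist x y"
    proof (rule eventually_sequentiallyI)
      fix m assume "N \<le> m"
      then have "lip_norm M (X n - X m) \<le> e" using N n by (simp add: less_imp_le)
      then show "dist ((X n - X m) x) ((X n - X m) y) \<le> e * dist x y"
        using lipschitz_onD[OF Lip0_lipschitz[OF D] xy, of n m] mult_right_mono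
        by (meson order_trans zero_le_dist)
    qed
    ultimately show "dist ((X n - l) x) ((X n - l) y) \<le> e * dist x y"
      by (rule tendsto_upperbound) simp
  qed (use e in simp)
  have "l \<in> Lip0 M p"
  proof -
    obtain N where "\<forall>m\<ge>N. \<forall>n\<ge>N. lip_norm M (X m - X n) < 1" using C[of 1] by auto
    from key[OF zero_less_one this order_refl] have "1-lipschitz_on M (X N - l)" .
    then have "X N - l \<in> Lip0 M p"
      using X l0 by (auto simp: Lip0_def)
    then have "X N - (X N - l) \<in> Lip0 M p" by (rule subspace_diff[OF subspace_Lip0 X])
    moreover have "X N - (X N - l) = l" by (simp add: fun_eq_iff)
    ultimately show ?thesis by simp
  qed
  moreover have "(\<lambda>n. lip_norm M (X n - l)) \<longlonglongrightarrow> 0"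
  proof (rule LIMSEQ_I)
    fix e :: real assume e: "e > 0"
    then obtain N where N: "\<forall>m\<ge>N. \<forall>n\<ge>N. lip_norm M (X m - X n) < e / 2"
      using C[of "e / 2"] by auto
    show "\<exists>N. \<forall>n\<ge>N. norm (lip_norm M (X n - l) - 0) < e"
    proof (intro exI[of _ N] allI impI)
      fix n assume "N \<le> n"
      with key[OF _ N] e have "(e / 2)-lipschitz_on M (X n - l)" by simp
      from lip_norm_le[OF this] lip_norm_nonneg[OF this] e
      show "norm (lip_norm M (X n - l) - 0) < e" by simp
    qed
  qed
  ultimately show ?thesis by blast
qed

lemma banach_on_Lip0:
  assumes p: "p \<in> M" shows "banach_on (Lip0 M p) (lip_norm M)"
  unfolding banach_on_def
proof (intro conjI ballI allI impI)
  show "subspace (Lip0 M p)" by (rule subspace_Lip0)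
next
  fix f assume f: "f \<in> Lip0 M p"
  show "0 \<le> lip_norm M f" using Lip0_lipschitz[OF f] by (rule lip_norm_nonneg)
  show "lip_norm M f = 0 \<longleftrightarrow> f = 0"
  proof
    assume "lip_norm M f = 0"
    then have "f x = 0" for x
      using Lip0_abs_le[OF f p, of x] f by (cases "x \<in> M") (auto simp: Lip0_def)
    then show "f = 0" by (simp add: fun_eq_iff)
  next
    assume "f = 0"
    then have "0-lipschitz_on M f" by (auto intro!: lipschitz_onI)
    from lip_norm_le[OF this] lip_norm_nonneg[OF this] show "lip_norm M f = 0" by simp
  qed
next
  fix c f assume f: "f \<in> Lip0 M p"
  show "lip_norm M (c *\<^sub>R f) = \<bar>c\<bar> * lip_norm M f"
  proof (cases "c = 0")
    case True
    have "0 \<le> lip_norm M (c *\<^sub>R f)"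
      by (rule lip_norm_nonneg, rule Lip0_lipschitz[of _ M p], intro subspace_scale subspace_Lip0 f)
    then show ?thesis using lip_norm_scaleR_le[OF f, of c] True by simp
  next
    case False
    have "c *\<^sub>R f \<in> Lip0 M p" by (intro subspace_scale subspace_Lip0 f)
    from lip_norm_scaleR_le[OF this, of "inverse c"] False
    have "\<bar>c\<bar> * lip_norm M f \<le> lip_norm M (c *\<^sub>R f)" by (simp add: field_simps)
    then show ?thesis using lip_norm_scaleR_le[OF f, of c] by simp
  qed
next
  fix f g assume "f \<in> Lip0 M p" "g \<in> Lip0 M p"
  then show "lip_norm M (f + g) \<le> lip_norm M f + lip_norm M g"
    unfolding plus_fun_def by (intro lip_norm_le lipschitz_on_add Lip0_lipschitz)
next
  fix X :: "nat \<Rightarrow> 'a \<Rightarrow> real" assume "(\<forall>n. X n \<in> Lip0 M p) \<and>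
    (\<forall>e>0. \<exists>N. \<forall>m\<ge>N. \<forall>n\<ge>N. lip_norm M (X m - X n) < e)"
  then show "\<exists>l\<in>Lip0 M p. (\<lambda>n. lip_norm M (X n - l)) \<longlonglongrightarrow> 0"
    by (intro Lip0_complete[OF p]) auto
qed


section \<open>The metric spaces $K_n$\<close>

text \<open>As \<^typ>\<open>nat\<close> is discrete, the bounded continuous functions \<^typ>\<open>nat \<Rightarrow>\<^sub>C real\<close>
  with their supremum metric are exactly $\ell_\infty$; sequences are indexed from \<open>0\<close>.\<close>

type_synonym l_infty = "nat \<Rightarrow>\<^sub>C real"

definition K :: "nat \<Rightarrow> l_infty set" where
  "K n = {x. \<forall>j. \<exists>k\<le>n. apply_bcontfun x j = real k}"

lemma dist_l_infty:
  fixes x y :: l_infty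
  shows "dist x y = (SUP j. \<bar>apply_bcontfun x j - apply_bcontfun y j\<bar>)"
  by (simp add: dist_bcontfun.rep_eq dist_real_def)

lemma bij_betw_K:
  "bij_betw (\<lambda>x. apply_bcontfun x) (K n) {x. \<forall>j. \<exists>k\<le>n. x j = real k}"
proof (rule bij_betwI[where g = Bcontfun])
  have *: "x \<in> bcontfun" if "\<forall>j. \<exists>k\<le>n. x j = real k" for x :: "nat \<Rightarrow> real"
    unfolding bcontfun_def
  proof (intro CollectI conjI)
    have "\<bar>x j\<bar> \<le> real n" for j
      using that[rule_format, of j] by auto
    then show "bounded (range x)"
      by (intro boundedI[of _ "real n"]) auto
  qed simp
  then show "Bcontfun \<in> {x. \<forall>j. \<exists>k\<le>n. x j = real k} \<rightarrow> K n"
    by (auto simp: K_def Bcontfun_inverse)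
  show "apply_bcontfun (Bcontfun x) = x" if "x \<in> {x. \<forall>j. \<exists>k\<le>n. x j = real k}" for x :: "nat \<Rightarrow> real"
    using that by (intro Bcontfun_inverse *) simp
qed (auto simp: K_def apply_bcontfun_inverse)

lemma Lip0_K_nontrivial:
  assumes "n \<ge> 1" "p \<in> K n"
  shows "\<exists>f\<in>Lip0 (K n) p. f \<noteq> 0"
proof -
  have "const_bcontfun 0 \<in> K n" "const_bcontfun 1 \<in> K n"
    using assms by (auto simp: K_def const_bcontfun.rep_eq intro: exI[of _ 0] exI[of _ 1])
  moreover have "const_bcontfun (0::real) \<noteq> (const_bcontfun 1 :: l_infty)"
    by (metis const_bcontfun.rep_eq zero_neq_one)
  ultimately obtain q where q: "q \<in> K n" "q \<noteq> p" by metis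
  define f where "f = (\<lambda>x. if x \<in> K n then dist x p else 0)"
  have "1-lipschitz_on (K n) f"
  proof (rule lipschitz_onI)
    fix x y assume "x \<in> K n" "y \<in> K n"
    then show "dist (f x) (f y) \<le> 1 * dist x y"
      using dist_triangle[of x p y] dist_triangle[of y p x]
      by (simp add: f_def dist_real_def dist_commute abs_le_iff)
  qed simp
  then have "f \<in> Lip0 (K n) p" by (auto simp: Lip0_def f_def)
  moreover have "f q \<noteq> 0" using q by (simp add: f_def)
  ultimately show ?thesis by (metis zero_fun_apply)
qed

end

theory Submission
  imports Defs
begin

text \<open>
  Distinct points of \<open>K n\<close> are at distance at least \<open>1\<close>. Hence every function on \<open>K n\<close> bounded by
  \<open>1\<close> is \<open>2\<close>-Lipschitz, and if functions \<open>u k\<close> bounded by \<open>1\<close> have pairwise disjoint supports, then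
  all signed finite sums of them have norm at most \<open>2\<close>; so a bounded functional is small on all but
  finitely many \<open>u k\<close> (\<open>finite_large_disjoint\<close>). It thus suffices to find, for every \<open>1\<close>-Lipschitz
  \<open>f\<close>, infinitely many \<^emph>\<open>disjointly supported\<close> perturbations \<open>F\<close> of \<open>f\<close> that leave room for a
  \<open>g\<close> of norm \<open>1\<close>, where \<open>g\<close> depends only on the place of the perturbation and not on \<open>f\<close>.

  The place number \<open>k\<close> is the set \<open>peak n k\<close> of all nonzero sequences that attain their maximum only
  at the indices \<open>2k\<close> and \<open>2k+1\<close>. The function \<open>g\<close> takes the values \<open>1/2\<close> and \<open>-1/2\<close> at the unit
  vectors with these two indices and vanishes elsewhere. To make room for it, note that the set
  \<open>K 1\<close> of zero-one sequences has diameter \<open>1\<close>, so that there is a number \<open>c\<close> with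
  \<open>\<bar>f - c\<bar> \<le> 1/2\<close> on \<open>K 1\<close>. A sequence \<open>z\<close> with maximum \<open>m \<ge> 1\<close> is at distance \<open>m - 1\<close> from \<open>K 1\<close>,
  whence \<open>\<bar>f z - c\<bar> \<le> m - 1/2\<close>. On \<open>peak n k\<close> this bound is lowered by \<open>1\<close> (but not below \<open>0\<close>)
  by truncating \<open>f - c\<close>. The truncated function \<open>F\<close> is still \<open>1\<close>-Lipschitz because of the following
  (\<open>norm_gap\<close>): if \<open>z\<close> lies in \<open>peak n k\<close> and \<open>w\<close> does not, then the maximum of \<open>w\<close> is at most that
  of \<open>z\<close> plus \<open>dist z w - 1\<close>. For the same reason \<open>\<bar>F w - c\<bar> \<le> dist w e - 1/2\<close> for the two unit
  vectors \<open>e\<close> and all other \<open>w\<close>, and \<open>F\<close> equals \<open>c\<close> at both of them; hence \<open>F + g\<close> and \<open>F - g\<close> are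
  \<open>1\<close>-Lipschitz.
\<close>

section \<open>Functionals and disjointly supported functions\<close>

lemma dual_space_sum:
  assumes \<phi>: "\<phi> \<in> dual_space V nrm" and V: "subspace V"
    and "finite F" and "\<And>k. k \<in> F \<Longrightarrow> u k \<in> V"
  shows "\<phi> (\<Sum>k\<in>F. a k *\<^sub>R u k) = (\<Sum>k\<in>F. a k * \<phi> (u k))"
  using assms(3,4)
proof (induction F rule: finite_induct)
  case empty
  have "\<phi> (0 *\<^sub>R 0) = 0 * \<phi> 0"
    using \<phi> subspace_0[OF V] unfolding dual_space_def by blast
  then show ?case by simp
next
  case (insert k F)
  have "a k *\<^sub>R u k \<in> V" "(\<Sum>k\<in>F. a k *\<^sub>R u k) \<in> V"
    using insert by (auto intro!: subspace_scale[OF V] subspace_sum[OF V])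
  then have "\<phi> (a k *\<^sub>R u k + (\<Sum>k\<in>F. a k *\<^sub>R u k)) = a k * \<phi> (u k) + \<phi> (\<Sum>k\<in>F. a k *\<^sub>R u k)"
    using \<phi> insert.prems unfolding dual_space_def by auto
  then show ?case using insert by simp
qed

lemma sum_scaleR_fun_apply:
  "(\<Sum>k\<in>F. a k *\<^sub>R u k) z = (\<Sum>k\<in>F. a k * u k z)" for u :: "'i \<Rightarrow> 'b \<Rightarrow> real"
  by (induction F rule: infinite_finite_induct) (simp_all add: scaleR_fun_def)

lemma lipschitz_of_bounded:
  fixes u :: "'a::metric_space \<Rightarrow> real"
  assumes "\<And>x y. x \<in> M \<Longrightarrow> y \<in> M \<Longrightarrow> x \<noteq> y \<Longrightarrow> dist x y \<ge> 1"
    and "\<And>x. x \<in> M \<Longrightarrow> \<bar>u x\<bar> \<le> b" and "b \<ge> 0"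
  shows "(2 * b)-lipschitz_on M u"
proof (rule lipschitz_onI)
  fix x y assume xy: "x \<in> M" "y \<in> M"
  show "dist (u x) (u y) \<le> 2 * b * dist x y"
  proof (cases "x = y")
    case False
    have "dist (u x) (u y) \<le> 2 * b * 1"
      using assms(2)[OF xy(1)] assms(2)[OF xy(2)] by (simp add: dist_real_def)
    also have "\<dots> \<le> 2 * b * dist x y"
      using assms(1)[OF xy False] assms(3) by (intro mult_left_mono) auto
    finally show ?thesis .
  qed simp
qed (use assms(3) in simp)

text \<open>For finitely many \<open>k\<close> with \<open>\<bar>\<phi> (u k)\<bar> \<ge> \<eta>\<close>, the sum \<open>H\<close> of the \<open>u k\<close> with the signs of
  \<open>\<phi> (u k)\<close> is bounded by \<open>1\<close>, because at every point at most one summand is nonzero. So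
  \<open>\<phi> H\<close>, which is at least \<open>\<eta>\<close> times the number of summands, is at most \<open>2 * C\<close>, where \<open>C\<close> is
  a bound for \<open>\<phi>\<close>.\<close>

lemma finite_large_disjoint:
  fixes u :: "'i \<Rightarrow> 'a::metric_space \<Rightarrow> real"
  assumes sep: "\<And>x y. x \<in> M \<Longrightarrow> y \<in> M \<Longrightarrow> x \<noteq> y \<Longrightarrow> dist x y \<ge> 1"
    and \<phi>: "\<phi> \<in> dual_space (Lip0 M p) (lip_norm M)"
    and u: "\<And>k. k \<in> I \<Longrightarrow> u k \<in> Lip0 M p"
    and bd: "\<And>k x. k \<in> I \<Longrightarrow> \<bar>u k x\<bar> \<le> 1"
    and supp: "\<And>k x. k \<in> I \<Longrightarrow> x \<notin> T k \<Longrightarrow> u k x = 0"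
    and disj: "disjoint_family_on T I"
    and \<eta>: "\<eta> > 0"
  shows "finite {k \<in> I. \<bar>\<phi> (u k)\<bar> \<ge> \<eta>}"
proof -
  obtain C where C: "\<And>x. x \<in> Lip0 M p \<Longrightarrow> \<bar>\<phi> x\<bar> \<le> C * lip_norm M x"
    using \<phi> unfolding dual_space_def by blast
  have card: "card F \<le> nat \<lceil>2 * \<bar>C\<bar> / \<eta>\<rceil>"
    if F: "F \<subseteq> {k \<in> I. \<bar>\<phi> (u k)\<bar> \<ge> \<eta>}" "finite F" for F
  proof -
    define H where "H = (\<Sum>k\<in>F. sgn (\<phi> (u k)) *\<^sub>R u k)"
    have HV: "H \<in> Lip0 M p"
      unfolding H_def using F u by (intro subspace_sum subspace_Lip0 subspace_scale) auto
    have Hb: "\<bar>H x\<bar> \<le> 1" for x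
    proof (cases "\<exists>k\<in>F. x \<in> T k")
      case True
      then obtain k where k: "k \<in> F" "x \<in> T k" by blast
      have "u l x = 0" if "l \<in> F - {k}" for l
        using that k F disj by (intro supp) (auto simp: disjoint_family_on_def)
      then have "H x = sgn (\<phi> (u k)) * u k x"
        unfolding H_def sum_scaleR_fun_apply using k(1) F(2) by (subst sum.remove[of _ k]) auto
      moreover have "\<bar>u k x\<bar> \<le> 1" using bd F k by auto
      ultimately show ?thesis by (simp add: abs_mult sgn_real_def)
    next
      case False
      then have "H x = 0"
        unfolding H_def sum_scaleR_fun_apply using F supp by (intro sum.neutral) auto
      then show ?thesis by simp
    qed
    have L: "2-lipschitz_on M H"
      using lipschitz_of_bounded[of M H 1] sep Hb by simp
    have "real (card F) * \<eta> = (\<Sum>k\<in>F. \<eta>)" by simp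
    also have "\<dots> \<le> (\<Sum>k\<in>F. \<bar>\<phi> (u k)\<bar>)" using F by (intro sum_mono) auto
    also have "\<dots> = (\<Sum>k\<in>F. sgn (\<phi> (u k)) * \<phi> (u k))"
      by (intro sum.cong) (simp_all add: sgn_mult_self_eq abs_sgn mult.commute)
    also have "\<dots> = \<phi> H"
      unfolding H_def using F u by (intro dual_space_sum[OF \<phi> subspace_Lip0, symmetric]) auto
    also have "\<dots> \<le> C * lip_norm M H" using C[OF HV] by simp
    also have "\<dots> \<le> \<bar>C\<bar> * 2"
      using lip_norm_le[OF L] lip_norm_nonneg[OF L] by (intro mult_mono) auto
    finally have "real (card F) \<le> 2 * \<bar>C\<bar> / \<eta>" using \<eta> by (simp add: field_simps)
    then show ?thesis by linarith
  qed
  show ?thesis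
    using finite_if_finite_subsets_card_bdd[of "{k \<in> I. \<bar>\<phi> (u k)\<bar> \<ge> \<eta>}"] card by blast
qed

lemma slice_nonempty:
  assumes \<phi>: "\<phi> \<in> dual_sphere V nrm" and V: "banach_on V nrm" and \<alpha>: "\<alpha> > 0"
  shows "\<exists>f. f \<in> slice V nrm \<phi> \<alpha>"
proof -
  have sub: "subspace V" and sc: "\<And>a x. x \<in> V \<Longrightarrow> nrm (a *\<^sub>R x) = \<bar>a\<bar> * nrm x"
    and nn: "\<And>x. x \<in> V \<Longrightarrow> 0 \<le> nrm x" and n0: "nrm 0 = 0"
    using V unfolding banach_on_def by (auto simp: subspace_0)
  obtain C where C: "\<And>x. x \<in> V \<Longrightarrow> \<bar>\<phi> x\<bar> \<le> C * nrm x"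
    and lin: "\<And>a x. x \<in> V \<Longrightarrow> \<phi> (a *\<^sub>R x) = a * \<phi> x"
    using \<phi> unfolding dual_sphere_def dual_space_def by blast
  have ub: "\<bar>\<phi> x\<bar> \<le> \<bar>C\<bar>" if "x \<in> unit_ball V nrm" for x
  proof -
    have "C * nrm x \<le> \<bar>C\<bar> * 1"
      using that nn by (intro mult_mono) (auto simp: unit_ball_def)
    then show ?thesis using C[of x] that by (auto simp: unit_ball_def)
  qed
  have "0 \<in> unit_ball V nrm" using sub n0 by (auto simp: unit_ball_def subspace_0)
  moreover have "1 - \<alpha> < (SUP x\<in>unit_ball V nrm. \<bar>\<phi> x\<bar>)"
    using \<phi> \<alpha> by (simp add: dual_sphere_def dual_norm_def)
  moreover have "bdd_above ((\<lambda>x. \<bar>\<phi> x\<bar>) ` unit_ball V nrm)"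
    using ub by (intro bdd_aboveI2[of _ _ "\<bar>C\<bar>"])
  ultimately obtain x where x: "x \<in> unit_ball V nrm" "1 - \<alpha> < \<bar>\<phi> x\<bar>"
    by (metis less_cSUP_iff empty_iff)
  define y where "y = (if \<phi> x \<ge> 0 then 1 else -1) *\<^sub>R x"
  have xV: "x \<in> V" "nrm x \<le> 1" using x by (auto simp: unit_ball_def)
  have "\<phi> y = \<bar>\<phi> x\<bar>" unfolding y_def lin[OF xV(1)] by simp
  moreover have "nrm y \<le> 1" unfolding y_def sc[OF xV(1)] using xV by simp
  moreover have "y \<in> V" unfolding y_def using sub xV by (intro subspace_scale)
  ultimately show ?thesis using x by (auto simp: slice_def unit_ball_def)
qed

section \<open>The geometry of the spaces of integer sequences\<close>

lemma dist_l_infty_le: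
  fixes x y :: l_infty
  assumes "\<And>j. \<bar>apply_bcontfun x j - apply_bcontfun y j\<bar> \<le> b"
  shows "dist x y \<le> b"
  using assms by (intro dist_bound) (auto simp: dist_real_def)

lemma dist_l_infty_ge: "\<bar>apply_bcontfun x j - apply_bcontfun y j\<bar> \<le> dist x y" for x y :: l_infty
  using dist_bounded[of x j y] by (simp add: dist_real_def)

lemma K_dist_ge_1:
  assumes "x \<in> K n" "y \<in> K n" "x \<noteq> y"
  shows "dist x y \<ge> 1"
proof -
  obtain j where j: "apply_bcontfun x j \<noteq> apply_bcontfun y j"
    using assms(3) by (metis bcontfun_eqI)
  obtain a b :: nat where "apply_bcontfun x j = a" "apply_bcontfun y j = b"
    using assms unfolding K_def by blast
  then show ?thesis using j dist_l_infty_ge[of x j y] by (cases a b rule: linorder_cases) auto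
qed

lemma K_value:
  assumes "z \<in> K n"
  obtains k where "apply_bcontfun z j = real k" "k \<le> n"
  using assms unfolding K_def by blast

lemma K_nonneg: "z \<in> K n \<Longrightarrow> 0 \<le> apply_bcontfun z j"
  using K_value[of z n j] by (metis of_nat_0_le_iff)

lemma K_le_norm: "apply_bcontfun z j \<le> norm z" for z :: l_infty
  using norm_bounded[of z j] by simp

lemma K_norm_attained:
  assumes "z \<in> K n"
  obtains j where "apply_bcontfun z j = norm z"
proof -
  let ?R = "range (apply_bcontfun z)"
  have "?R \<subseteq> real ` {..n}" using assms unfolding K_def by fastforce
  then have fin: "finite ?R" by (rule finite_subset) simp
  then have "Max ?R \<in> ?R" by (intro Max_in) auto
  then obtain j where j: "apply_bcontfun z j = Max ?R" by auto
  have "norm z \<le> apply_bcontfun z j"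
    using fin K_nonneg[OF assms] by (intro norm_bound) (auto simp: j)
  with K_le_norm[of z j] that[of j] show thesis by simp
qed

lemma K_norm_Nats:
  assumes "z \<in> K n"
  shows "norm z \<in> \<nat>"
proof -
  obtain j where j: "apply_bcontfun z j = norm z" using K_norm_attained[OF assms] .
  obtain k where "apply_bcontfun z j = real k" using K_value[OF assms] .
  with j show ?thesis by (metis of_nat_in_Nats)
qed

lemma K_norm_ge_1:
  assumes "z \<in> K n" "z \<noteq> 0"
  shows "norm z \<ge> 1"
proof -
  obtain m :: nat where m: "norm z = real m" using K_norm_Nats[OF assms(1)] by (rule Nats_cases)
  with assms(2) have "m \<noteq> 0" by (metis norm_eq_zero of_nat_0)
  with m show ?thesis by simp
qed

lemma K_dist_Nats:
  assumes "x \<in> K n" "y \<in> K n"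
  shows "dist x y \<in> \<nat>"
proof -
  have "dist x y \<in> real ` {..n}"
  proof -
    let ?R = "range (\<lambda>j. \<bar>apply_bcontfun x j - apply_bcontfun y j\<bar>)"
    have sub: "?R \<subseteq> real ` {..n}"
    proof safe
      fix j
      obtain a b where "apply_bcontfun x j = real a" "a \<le> n" "apply_bcontfun y j = real b" "b \<le> n"
        using K_value[OF assms(1), of j] K_value[OF assms(2), of j] by metis
      then show "\<bar>apply_bcontfun x j - apply_bcontfun y j\<bar> \<in> real ` {..n}"
        by (intro image_eqI[of _ _ "nat \<bar>int a - int b\<bar>"]) auto
    qed
    then have fin: "finite ?R" by (rule finite_subset) simp
    then have "Sup ?R \<in> ?R" by (subst cSup_eq_Max) (auto intro: Max_in)
    then show ?thesis using sub unfolding dist_l_infty by blast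
  qed
  then show ?thesis by auto
qed

text \<open>The point of \<open>K 1\<close> closest to \<open>z\<close> arises from truncating all terms of \<open>z\<close> at \<open>1\<close>.\<close>

lemma K_near_K1:
  assumes "z \<in> K n"
  obtains y where "y \<in> K 1" "dist z y \<le> max (norm z) 1 - 1"
proof -
  let ?y = "\<lambda>j. min (apply_bcontfun z j) 1"
  have "\<exists>k\<le>1. ?y j = real k" for j
  proof -
    obtain k where "apply_bcontfun z j = real k" using assms unfolding K_def by blast
    then show ?thesis by (intro exI[of _ "min k 1"]) auto
  qed
  then have "?y \<in> apply_bcontfun ` K 1"
    using bij_betw_imp_surj_on[OF bij_betw_K[of 1]] by simp
  then obtain y where y: "y \<in> K 1" "apply_bcontfun y = ?y" by (metis imageE)
  have "dist z y \<le> max (norm z) 1 - 1"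
  proof (rule dist_l_infty_le)
    fix j
    show "\<bar>apply_bcontfun z j - apply_bcontfun y j\<bar> \<le> max (norm z) 1 - 1"
      using K_le_norm[of z j] by (simp add: y min_def max_def)
  qed
  with y that show thesis by blast
qed

text \<open>The unit vector with index \<open>i\<close>.\<close>

definition unit_vec :: "nat \<Rightarrow> l_infty" where
  "unit_vec i = Bcontfun (\<lambda>j. if j = i then 1 else 0)"

lemma apply_unit_vec: "apply_bcontfun (unit_vec i) = (\<lambda>j. if j = i then 1 else 0)"
proof -
  have "bounded (range (\<lambda>j. if j = i then 1 else (0::real)))"
    by (rule boundedI[of _ 1]) auto
  then show ?thesis unfolding unit_vec_def by (intro Bcontfun_inverse) (simp add: bcontfun_def)
qed

lemma unit_vec_K: "n \<ge> 1 \<Longrightarrow> unit_vec i \<in> K n"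
  unfolding K_def by (auto simp: apply_unit_vec intro: exI[of _ 0] exI[of _ 1])

lemma norm_unit_vec: "norm (unit_vec i) = 1"
proof (rule antisym)
  show "norm (unit_vec i) \<le> 1" by (rule norm_bound) (simp add: apply_unit_vec)
  show "1 \<le> norm (unit_vec i)" using K_le_norm[of "unit_vec i" i] by (simp add: apply_unit_vec)
qed

lemma dist_unit_vec: "i \<noteq> j \<Longrightarrow> dist (unit_vec i) (unit_vec j) = 1"
proof (rule antisym)
  show "dist (unit_vec i) (unit_vec j) \<le> 1" by (rule dist_l_infty_le) (simp add: apply_unit_vec)
  show "1 \<le> dist (unit_vec i) (unit_vec j)" if "i \<noteq> j"
    using dist_l_infty_ge[of "unit_vec i" i "unit_vec j"] that by (simp add: apply_unit_vec)
qed

text \<open>The nonzero sequences whose maximum, which equals the norm, is attained at no index other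
  than \<open>2k\<close> and \<open>2k+1\<close>.\<close>

definition peak :: "nat \<Rightarrow> nat \<Rightarrow> l_infty set" where
  "peak n k = {z \<in> K n. z \<noteq> 0 \<and> (\<forall>j. apply_bcontfun z j = norm z \<longrightarrow> j \<in> {2 * k, 2 * k + 1})}"

lemma disjoint_peak: "disjoint_family_on (peak n) I"
  unfolding disjoint_family_on_def
proof (intro ballI impI equals0I)
  fix k l z assume "k \<noteq> l" and z: "z \<in> peak n k \<inter> peak n l"
  have "z \<in> K n" using z by (simp add: peak_def)
  then obtain j where "apply_bcontfun z j = norm z" by (rule K_norm_attained)
  then have "j \<in> {2 * k, 2 * k + 1}" "j \<in> {2 * l, 2 * l + 1}" using z unfolding peak_def by blast+
  then have "k = l" by auto
  with \<open>k \<noteq> l\<close> show False ..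
qed

lemma unit_vec_peak: "n \<ge> 1 \<Longrightarrow> i \<in> {2 * k, 2 * k + 1} \<Longrightarrow> unit_vec i \<in> peak n k"
  using norm_unit_vec[of i] unit_vec_K[of n i]
  by (auto simp: peak_def apply_unit_vec split: if_splits)

text \<open>The norms and the distance are integers. If the norm grows by the full distance on the way from \<open>z\<close> to \<open>w\<close>, then \<open>w\<close> attains its maximum
  only where \<open>z\<close> does.\<close>

lemma norm_gap:
  assumes z: "z \<in> peak n k" and w: "w \<in> K n" "w \<notin> peak n k"
  shows "norm w \<le> norm z + dist z w - 1"
proof (rule ccontr)
  assume less: "\<not> ?thesis"
  have zK: "z \<in> K n" "z \<noteq> 0" using z by (auto simp: peak_def)
  obtain a b d :: nat where abd: "norm z = a" "norm w = b" "dist z w = d"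
    using K_norm_Nats[OF zK(1)] K_norm_Nats[OF w(1)] K_dist_Nats[OF zK(1) w(1)]
    by (auto elim!: Nats_cases)
  have "norm w \<le> norm z + dist z w"
    using norm_triangle_ineq[of z "w - z"] by (simp add: dist_norm norm_minus_commute)
  with less abd have "real b \<le> real (a + d)" "real (a + d) < real (b + 1)" by simp_all
  then have "b = a + d" unfolding of_nat_le_iff of_nat_less_iff by linarith
  with abd have eq: "norm w = norm z + dist z w" by simp
  have "w \<noteq> 0" using eq K_norm_ge_1[OF zK] zero_le_dist[of z w] by auto
  moreover have "j \<in> {2 * k, 2 * k + 1}" if "apply_bcontfun w j = norm w" for j
  proof -
    have "apply_bcontfun z j = norm z"
      using that eq dist_l_infty_ge[of z j w] K_le_norm[of z j] by linarith
    then show ?thesis using z by (auto simp: peak_def)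
  qed
  ultimately show False using w by (auto simp: peak_def)
qed

section \<open>The perturbation\<close>

lemma exists_centre:
  fixes f :: "l_infty \<Rightarrow> real"
  assumes n: "n \<ge> 1" and f: "1-lipschitz_on (K n) f"
  shows "\<exists>c. \<forall>z\<in>K n. \<bar>f z - c\<bar> \<le> max (norm z) 1 - 1 / 2"
proof -
  have sub: "y \<in> K n" if "y \<in> K 1" for y
  proof -
    have "\<exists>k\<le>n. apply_bcontfun y j = real k" for j
      using K_value[OF that, of j] n order_trans by metis
    then show ?thesis by (simp add: K_def)
  qed
  have osc: "f x \<le> f y + 1" if xy: "x \<in> K 1" "y \<in> K 1" for x y
  proof -
    have "dist x y \<le> 1"
    proof (rule dist_l_infty_le)
      fix j
      obtain a b where "apply_bcontfun x j = real a" "a \<le> 1" "apply_bcontfun y j = real b" "b \<le> 1"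
        using K_value[OF xy(1), of j] K_value[OF xy(2), of j] by metis
      then show "\<bar>apply_bcontfun x j - apply_bcontfun y j\<bar> \<le> 1" by linarith
    qed
    then show ?thesis using lipschitz_onD[OF f sub sub, OF xy] by (simp add: dist_real_def)
  qed
  have e: "unit_vec 0 \<in> K 1" by (simp add: unit_vec_K)
  define c where "c = (INF y\<in>K 1. f y) + 1 / 2"
  have bdd: "bdd_below (f ` K 1)"
    using osc[OF e] by (intro bdd_belowI2[of _ "f (unit_vec 0) - 1"]) (simp add: algebra_simps)
  have c: "\<bar>f y - c\<bar> \<le> 1 / 2" if "y \<in> K 1" for y
  proof -
    have "(INF y\<in>K 1. f y) \<le> f y" using bdd that by (rule cINF_lower)
    moreover have "f y - 1 \<le> (INF y\<in>K 1. f y)"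
      using e osc[OF that] by (intro cINF_greatest) (auto simp: algebra_simps)
    ultimately show ?thesis unfolding c_def by linarith
  qed
  have "\<bar>f z - c\<bar> \<le> max (norm z) 1 - 1 / 2" if z: "z \<in> K n" for z
  proof -
    obtain y where y: "y \<in> K 1" "dist z y \<le> max (norm z) 1 - 1" using K_near_K1[OF z] .
    have "\<bar>f z - f y\<bar> \<le> dist z y"
      using lipschitz_onD[OF f z sub[OF y(1)]] by (simp add: dist_real_def)
    with c[OF y(1)] y(2) show ?thesis by linarith
  qed
  then show ?thesis by blast
qed

text \<open>Half the difference of the indicator functions of the two unit vectors in \<open>peak n k\<close>.\<close>

definition bump :: "nat \<Rightarrow> l_infty \<Rightarrow> real" where
  "bump k z = (if z = unit_vec (2 * k) then 1 / 2
               else if z = unit_vec (2 * k + 1) then - 1 / 2 else 0)"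

lemma bump_props:
  assumes n: "n \<ge> 1"
  shows "\<bar>bump k z\<bar> \<le> 1 / 2" and "z \<notin> peak n k \<Longrightarrow> bump k z = 0"
    and "1-lipschitz_on (K n) (bump k)" and "lip_norm (K n) (bump k) \<ge> 1"
proof -
  show b: "\<bar>bump k z\<bar> \<le> 1 / 2" for z by (simp add: bump_def)
  show "z \<notin> peak n k \<Longrightarrow> bump k z = 0"
    using unit_vec_peak[OF n, of "2 * k" k] unit_vec_peak[OF n, of "2 * k + 1" k]
    by (auto simp: bump_def)
  show L: "1-lipschitz_on (K n) (bump k)"
    using lipschitz_of_bounded[of "K n" "bump k" "1 / 2"] K_dist_ge_1 b by simp
  have d: "dist (unit_vec (2 * k)) (unit_vec (2 * k + 1)) = 1" by (rule dist_unit_vec) simp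
  then have ne: "unit_vec (2 * k + 1) \<noteq> unit_vec (2 * k)" by auto
  show "lip_norm (K n) (bump k) \<ge> 1"
    using lipschitz_onD[OF lipschitz_on_lip_norm[OF L] unit_vec_K[OF n] unit_vec_K[OF n],
        of "2 * k" "2 * k + 1"] d ne
    by (simp add: bump_def dist_real_def)
qed

text \<open>On \<open>peak n k\<close>, the function \<open>f - c\<close> is truncated at height \<open>max 0 (norm z - 3/2)\<close>, which is
  \<open>1\<close> less than the bound on \<open>\<bar>f - c\<bar>\<close> in \<open>exists_centre\<close> as long as this is nonnegative.\<close>

definition flatten :: "nat \<Rightarrow> real \<Rightarrow> nat \<Rightarrow> (l_infty \<Rightarrow> real) \<Rightarrow> l_infty \<Rightarrow> real" where
  "flatten n c k f z =
     (if z \<in> peak n k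
      then c + max (- max 0 (norm z - 3 / 2)) (min (max 0 (norm z - 3 / 2)) (f z - c)) else f z)"

context
  fixes n k :: nat and f :: "l_infty \<Rightarrow> real" and c :: real
  assumes n: "n \<ge> 1" and f: "1-lipschitz_on (K n) f"
    and c: "\<And>z. z \<in> K n \<Longrightarrow> \<bar>f z - c\<bar> \<le> max (norm z) 1 - 1 / 2"
begin

lemma flatten_near: "\<bar>flatten n c k f z - f z\<bar> \<le> 1"
proof (cases "z \<in> peak n k")
  case True
  then have "z \<in> K n" "norm z \<ge> 1" using K_norm_ge_1 by (auto simp: peak_def)
  with c[of z] True show ?thesis unfolding flatten_def by auto
qed (simp add: flatten_def)

lemma flatten_lipschitz_peak:
  assumes z: "z \<in> peak n k" and w: "w \<in> K n"
  shows "\<bar>flatten n c k f z - flatten n c k f w\<bar> \<le> dist z w"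
proof (cases "z = w")
  case False
  have zK: "z \<in> K n" "norm z \<ge> 1" using z K_norm_ge_1 by (auto simp: peak_def)
  have L: "\<bar>f z - f w\<bar> \<le> dist z w"
    using lipschitz_onD[OF f zK(1) w] by (simp add: dist_real_def)
  have d: "dist z w \<ge> 1" using K_dist_ge_1[OF zK(1) w False] .
  have N: "\<bar>norm z - norm w\<bar> \<le> dist z w" by (simp add: dist_norm norm_triangle_ineq3)
  show ?thesis
  proof (cases "w \<in> peak n k")
    case True
    show ?thesis using z True L N unfolding flatten_def by (auto simp: max_def min_def)
  next
    case False
    have "\<bar>f w - c\<bar> \<le> max 0 (norm z - 3 / 2) + dist z w"
      using c[OF w] norm_gap[OF z w False] zK(2) d by linarith
    then show ?thesis using z False L unfolding flatten_def by (auto simp: max_def min_def)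
  qed
qed simp

lemma flatten_lipschitz:
  assumes z: "z \<in> K n" and w: "w \<in> K n"
  shows "\<bar>flatten n c k f z - flatten n c k f w\<bar> \<le> dist z w"
proof (cases "z \<in> peak n k \<or> w \<in> peak n k")
  case True
  then show ?thesis
    using flatten_lipschitz_peak[of z w] flatten_lipschitz_peak[of w z] z w
    by (auto simp: dist_commute abs_minus_commute)
next
  case False
  then show ?thesis
    using lipschitz_onD[OF f z w] by (simp add: flatten_def dist_real_def)
qed

lemma flatten_unit_vec:
  assumes "i \<in> {2 * k, 2 * k + 1}"
  shows "flatten n c k f (unit_vec i) = c"
  using unit_vec_peak[OF n assms] by (simp add: flatten_def norm_unit_vec)

lemma flatten_near_unit_vec:
  assumes i: "i \<in> {2 * k, 2 * k + 1}" and w: "w \<in> K n" "w \<noteq> unit_vec i"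
  shows "\<bar>flatten n c k f w - c\<bar> \<le> dist w (unit_vec i) - 1 / 2"
proof -
  let ?e = "unit_vec i"
  have d: "dist ?e w \<ge> 1" using K_dist_ge_1 w unit_vec_K[OF n, of i] by metis
  show ?thesis
  proof (cases "w \<in> peak n k")
    case True
    have "norm w \<le> 1 + dist ?e w"
      using norm_triangle_ineq[of ?e "w - ?e"]
      by (simp add: dist_norm norm_minus_commute norm_unit_vec)
    then show ?thesis using True d by (auto simp: flatten_def dist_commute)
  next
    case False
    have "norm w \<le> dist ?e w"
      using norm_gap[OF unit_vec_peak[OF n i] w(1) False] by (simp add: norm_unit_vec)
    with c[OF w(1)] d False show ?thesis by (auto simp: flatten_def dist_commute)
  qed
qed

lemma flatten_bump_unit_vec:
  assumes s: "\<bar>s\<bar> \<le> 1" and i: "i \<in> {2 * k, 2 * k + 1}" and w: "w \<in> K n"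
  shows "\<bar>(flatten n c k f w + s * bump k w) -
          (flatten n c k f (unit_vec i) + s * bump k (unit_vec i))\<bar> \<le> dist w (unit_vec i)"
proof -
  have sb: "\<bar>s * bump k z\<bar> \<le> 1 / 2" for z
    using mult_mono[OF s bump_props(1)[OF n, of k z]] by (simp add: abs_mult)
  consider "w = unit_vec i"
    | j where "j \<in> {2 * k, 2 * k + 1}" "w = unit_vec j" "w \<noteq> unit_vec i"
    | "w \<noteq> unit_vec (2 * k)" "w \<noteq> unit_vec (2 * k + 1)" "w \<noteq> unit_vec i"
    by blast
  then show ?thesis
  proof cases
    case 1
    then show ?thesis by simp
  next
    case 2
    have "dist w (unit_vec i) \<ge> 1" using K_dist_ge_1[OF w unit_vec_K[OF n]] 2 by blast
    moreover have "flatten n c k f w = c" using 2 flatten_unit_vec by blast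
    ultimately show ?thesis
      using flatten_unit_vec[OF i] sb[of w] sb[of "unit_vec i"] by linarith
  next
    case 3
    then have "bump k w = 0" by (simp add: bump_def)
    then show ?thesis
      using flatten_near_unit_vec[OF i w 3(3)] flatten_unit_vec[OF i] sb[of "unit_vec i"]
      by simp
  qed
qed

lemma flatten_bump_lipschitz:
  assumes s: "\<bar>s\<bar> \<le> 1"
  shows "1-lipschitz_on (K n) (\<lambda>z. flatten n c k f z + s * bump k z)"
proof (rule lipschitz_onI)
  fix z w assume zw: "z \<in> K n" "w \<in> K n"
  consider i where "i \<in> {2 * k, 2 * k + 1}" "w = unit_vec i"
    | i where "i \<in> {2 * k, 2 * k + 1}" "z = unit_vec i"
    | "bump k z = 0" "bump k w = 0"
    unfolding bump_def by (metis insert_iff)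
  then show "dist (flatten n c k f z + s * bump k z) (flatten n c k f w + s * bump k w) \<le> 1 * dist z w"
  proof cases
    case 1
    then show ?thesis using flatten_bump_unit_vec[OF s 1(1) zw(1)] by (simp add: dist_real_def)
  next
    case 2
    then show ?thesis using flatten_bump_unit_vec[OF s 2(1) zw(2)]
      by (simp add: dist_real_def dist_commute abs_minus_commute)
  next
    case 3
    then show ?thesis using flatten_lipschitz[OF zw] by (simp add: dist_real_def)
  qed
qed simp

end

section \<open>The symmetric strong diameter two property\<close>

theorem theorem1p2:
  fixes n :: nat and p :: l_infty
  assumes "n \<ge> 1" and "p \<in> K n"
  shows "SSD2P (Lip0 (K n) p) (lip_norm (K n))"
  unfolding SSD2P_def
proof (intro allI impI)
  fix m :: nat and S :: "nat \<Rightarrow> (l_infty \<Rightarrow> real) set" and \<epsilon> :: real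
  assume "\<epsilon> > 0" and S: "\<forall>i\<in>{1..m}. is_slice (Lip0 (K n) p) (lip_norm (K n)) (S i)"
  let ?V = "Lip0 (K n) p" and ?N = "lip_norm (K n)"
  have "\<exists>\<phi> \<alpha> f c. \<phi> \<in> dual_space ?V ?N \<and> S i = slice ?V ?N \<phi> \<alpha> \<and> f \<in> S i \<and>
      (\<forall>z\<in>K n. \<bar>f z - c\<bar> \<le> max (norm z) 1 - 1 / 2)" if i: "i \<in> {1..m}" for i
  proof -
    obtain \<phi> \<alpha> where \<phi>: "\<phi> \<in> dual_sphere ?V ?N" "\<alpha> > 0" "S i = slice ?V ?N \<phi> \<alpha>"
      using S i unfolding is_slice_def by blast
    obtain f where f: "f \<in> slice ?V ?N \<phi> \<alpha>"
      using slice_nonempty[OF \<phi>(1) banach_on_Lip0[OF assms(2)] \<phi>(2)] by blast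
    then have "?N f \<le> 1" "f \<in> ?V" by (auto simp: slice_def unit_ball_def)
    then have "1-lipschitz_on (K n) f" using Lip0_lipschitz lipschitz_on_le by blast
    then obtain c where "\<forall>z\<in>K n. \<bar>f z - c\<bar> \<le> max (norm z) 1 - 1 / 2"
      using exists_centre[OF assms(1)] by blast
    with \<phi> f show ?thesis unfolding dual_sphere_def by blast
  qed
  then obtain \<phi> \<alpha> f c where
    \<phi>: "\<And>i. i \<in> {1..m} \<Longrightarrow> \<phi> i \<in> dual_space ?V ?N" and
    Si: "\<And>i. i \<in> {1..m} \<Longrightarrow> S i = slice ?V ?N (\<phi> i) (\<alpha> i)" and
    f: "\<And>i. i \<in> {1..m} \<Longrightarrow> f i \<in> S i" and
    c: "\<And>i z. i \<in> {1..m} \<Longrightarrow> z \<in> K n \<Longrightarrow> \<bar>f i z - c i\<bar> \<le> max (norm z) 1 - 1 / 2"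
    by metis
  have fV: "f i \<in> ?V" and fL: "1-lipschitz_on (K n) (f i)" and f\<phi>: "\<phi> i (f i) > 1 - \<alpha> i"
    if "i \<in> {1..m}" for i
  proof -
    have "?N (f i) \<le> 1" and *: "f i \<in> ?V" "\<phi> i (f i) > 1 - \<alpha> i"
      using f[OF that] Si[OF that] by (auto simp: slice_def unit_ball_def)
    then show "1-lipschitz_on (K n) (f i)" using Lip0_lipschitz lipschitz_on_le by blast
    show "f i \<in> ?V" "\<phi> i (f i) > 1 - \<alpha> i" by (fact *)+
  qed
  have bump_le: "\<bar>bump k z\<bar> \<le> 1" for k z by (simp add: bump_def)
  \<comment> \<open>Functions supported in \<open>peak n k\<close> vanish at the base point, for all but at most one \<open>k\<close>.\<close>
  define I where "I = {k. p \<notin> peak n k}"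
  have "finite (- I)"
  proof (cases "\<exists>l. l \<notin> I")
    case True
    then obtain l where l: "l \<notin> I" by blast
    have "k = l" if "k \<notin> I" for k
      using that l disjoint_family_onD[OF disjoint_peak[of n UNIV], of k l] by (auto simp: I_def)
    then have "- I \<subseteq> {l}" by auto
    then show ?thesis by (rule finite_subset) simp
  next
    case False
    then have "- I = {}" by auto
    then show ?thesis by simp
  qed
  define F where "F i k = flatten n (c i) k (f i)" for i k
  \<comment> \<open>Half of the slack of \<open>f i\<close> in its slice: one half is for \<open>F i k - f i\<close>, the other for \<open>bump k\<close>.\<close>
  define \<eta> where "\<eta> i = (\<phi> i (f i) - (1 - \<alpha> i)) / 2" for i
  have Lip0I: "u \<in> ?V" if "k \<in> I" "\<And>z. z \<notin> peak n k \<Longrightarrow> u z = 0" "\<And>z. \<bar>u z\<bar> \<le> 1" for u k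
  proof -
    have "2-lipschitz_on (K n) u"
      using lipschitz_of_bounded[of "K n" u 1] K_dist_ge_1 that(3) by simp
    then show ?thesis using that(1,2) unfolding Lip0_def I_def peak_def by blast
  qed
  have small: "finite {k \<in> I. \<bar>\<phi> i (u k)\<bar> \<ge> \<eta> i}"
    if i: "i \<in> {1..m}" and u: "\<And>k z. z \<notin> peak n k \<Longrightarrow> u k z = 0" "\<And>k z. \<bar>u k z\<bar> \<le> 1" for i u
  proof (rule finite_large_disjoint[OF _ \<phi>[OF i], where T = "peak n"])
    show "dist x y \<ge> 1" if "x \<in> K n" "y \<in> K n" "x \<noteq> y" for x y using that by (rule K_dist_ge_1)
    show "u k \<in> ?V" if "k \<in> I" for k by (rule Lip0I[OF that u])
    show "\<eta> i > 0" using f\<phi>[OF i] by (simp add: \<eta>_def)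
  qed (simp_all add: u disjoint_peak)
  have Fs: "finite {k \<in> I. \<bar>\<phi> i (F i k - f i)\<bar> \<ge> \<eta> i}" if i: "i \<in> {1..m}" for i
    using flatten_near[OF assms(1) fL[OF i] c[OF i]]
    by (intro small[OF i]) (simp_all add: F_def flatten_def)
  have gs: "finite {k \<in> I. \<bar>\<phi> i (bump k)\<bar> \<ge> \<eta> i}" if i: "i \<in> {1..m}" for i
    using bump_props(2)[OF assms(1)] bump_le by (intro small[OF i])
  have "finite (- I \<union> (\<Union>i\<in>{1..m}. {k \<in> I. \<bar>\<phi> i (F i k - f i)\<bar> \<ge> \<eta> i}
                              \<union> {k \<in> I. \<bar>\<phi> i (bump k)\<bar> \<ge> \<eta> i}))"
    using Fs gs \<open>finite (- I)\<close> by simp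
  then obtain k where "k \<notin> - I \<union> (\<Union>i\<in>{1..m}. {k \<in> I. \<bar>\<phi> i (F i k - f i)\<bar> \<ge> \<eta> i}
                              \<union> {k \<in> I. \<bar>\<phi> i (bump k)\<bar> \<ge> \<eta> i})"
    using ex_new_if_finite[OF infinite_UNIV_nat] by blast
  then have k: "k \<in> I" and k1: "\<And>i. i \<in> {1..m} \<Longrightarrow> \<bar>\<phi> i (F i k - f i)\<bar> < \<eta> i"
    and k2: "\<And>i. i \<in> {1..m} \<Longrightarrow> \<bar>\<phi> i (bump k)\<bar> < \<eta> i"
    by (auto simp: not_le)
  have gV: "bump k \<in> ?V"
    using bump_props(2)[OF assms(1)] bump_le by (intro Lip0I[OF k])
  have in_S: "F i k + s *\<^sub>R bump k \<in> S i" if i: "i \<in> {1..m}" and s: "\<bar>s\<bar> \<le> 1" for i s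
  proof -
    have hV: "F i k - f i \<in> ?V"
      using flatten_near[OF assms(1) fL[OF i] c[OF i]]
      by (intro Lip0I[OF k]) (simp_all add: F_def flatten_def)
    have sV: "s *\<^sub>R bump k \<in> ?V" by (intro subspace_scale subspace_Lip0 gV)
    have eq: "F i k + s *\<^sub>R bump k = f i + ((F i k - f i) + s *\<^sub>R bump k)"
      by (simp add: fun_eq_iff)
    have hsV: "(F i k - f i) + s *\<^sub>R bump k \<in> ?V"
      by (intro subspace_add subspace_Lip0 hV sV)
    have V: "F i k + s *\<^sub>R bump k \<in> ?V"
      unfolding eq by (rule subspace_add[OF subspace_Lip0 fV[OF i] hsV])
    have "F i k + s *\<^sub>R bump k = (\<lambda>z. flatten n (c i) k (f i) z + s * bump k z)"
      by (simp add: fun_eq_iff F_def scaleR_fun_def)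
    then have N: "?N (F i k + s *\<^sub>R bump k) \<le> 1"
      using lip_norm_le flatten_bump_lipschitz[OF assms(1) fL[OF i] c[OF i] s] by metis
    have add: "\<And>x y. x \<in> ?V \<Longrightarrow> y \<in> ?V \<Longrightarrow> \<phi> i (x + y) = \<phi> i x + \<phi> i y"
      and scl: "\<And>a x. x \<in> ?V \<Longrightarrow> \<phi> i (a *\<^sub>R x) = a * \<phi> i x"
      using \<phi>[OF i] unfolding dual_space_def by blast+
    have "\<phi> i (F i k + s *\<^sub>R bump k) = \<phi> i (f i) + (\<phi> i (F i k - f i) + s * \<phi> i (bump k))"
      unfolding eq by (simp only: add[OF fV[OF i] hsV] add[OF hV sV] scl[OF gV])
    moreover have "\<bar>s * \<phi> i (bump k)\<bar> < \<eta> i"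
      using mult_right_mono[OF s abs_ge_zero[of "\<phi> i (bump k)"]] k2[OF i] by (simp add: abs_mult)
    then have "s * \<phi> i (bump k) > - \<eta> i" by (simp add: abs_less_iff)
    moreover have "\<phi> i (F i k - f i) > - \<eta> i" using k1[OF i] by (simp add: abs_less_iff)
    moreover have "\<phi> i (f i) = 1 - \<alpha> i + 2 * \<eta> i" by (simp add: \<eta>_def field_simps)
    ultimately have "\<phi> i (F i k + s *\<^sub>R bump k) > 1 - \<alpha> i" by linarith
    then show ?thesis using Si[OF i] V N by (simp add: slice_def unit_ball_def)
  qed
  show "\<exists>f g. (\<forall>i\<in>{1..m}. f i \<in> S i) \<and> g \<in> unit_ball ?V ?N \<and> ?N g > 1 - \<epsilon> \<and>
      (\<forall>i\<in>{1..m}. f i + g \<in> S i \<and> f i - g \<in> S i)"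
  proof (intro exI[of _ "\<lambda>i. F i k"] exI[of _ "bump k"] conjI ballI)
    show "bump k \<in> unit_ball ?V ?N"
      using gV lip_norm_le[OF bump_props(3)[OF assms(1)]] by (simp add: unit_ball_def)
    show "?N (bump k) > 1 - \<epsilon>"
      using bump_props(4)[OF assms(1), of k] \<open>\<epsilon> > 0\<close> by linarith
    fix i assume i: "i \<in> {1..m}"
    show "F i k \<in> S i" using in_S[OF i, of 0] by simp
    show "F i k + bump k \<in> S i" using in_S[OF i, of 1] by simp
    show "F i k - bump k \<in> S i" using in_S[OF i, of "- 1"] by simp
  qed
qed

end
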